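(* Let $\mathbf k\in(\mathbb N\cup\{\infty\})^\ell$. The ideal $\mathcal I\mathcal E^{\mathbf k}\subseteq\mathrm{NSym}^{(\ell)}$ is the two-sided ideal generated by $\{S_{\mathbf n}:\mathbf 0<\mathbf n\le\mathbf k,\ |\mathbf n|\text{ odd}\}$, and the $\mathbf k$-even subalgebra $\mathcal E^{\mathbf k}\subseteq\mathrm{QSym}^{(\ell)}$ is the $\mathbb Q$-span of those $M_{(\mathbf i_1,\dots,\mathbf i_m)}$ such that for every $r$, $\mathbf i_r\le\mathbf k$ implies $|\mathbf i_r|$ even.
   Context: Fix $\ell\ge1$; $|\mathbf n|=\sum n_i$, coordinatewise order on $(\mathbb N\cup\{\infty\})^\ell$. $\mathrm{QSym}^{(\ell)}$ is the $\mathbb Q$-span of $M_{\mathbf I}=\sum_{j_1<\dots<j_m}\mathbf x_{j_1}^{\mathbf i_1}\cdots\mathbf x_{j_m}^{\mathbf i_m}$ over vector compositions $\mathbf I=(\mathbf i_1,\dots,\mathbf i_m)$ (sequences of nonzero elements of $\mathbb N^\ell$) in commuting variables $x_j^{(i)}$ ($\mathbf x_j^{\mathbf n}=\prod_i(x_j^{(i)})^{n_i}$), a graded Hopf algebra with product of power series and deconcatenation coproduct. $\mathrm{NSym}^{(\ell)}$ is the graded dual, with basis $S^{\mathbf I}$ dual to $M_{\mathbf I}$, $S_{\mathbf n}=S^{(\mathbf n)}$, and $S^{\mathbf I}=S_{\mathbf i_1}\cdots S_{\mathbf i_m}$. $\zeta_{\mathcal Q}(M_{\mathbf I})=1$ if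 $\mathbf I$ has length $\le1$, else $0$ (so its degree-$\mathbf n$ part is $S_{\mathbf n}$); $\bar\zeta_{\mathcal Q}(h)=(-1)^{|\mathbf n|}\zeta_{\mathcal Q}(h)$ on degree $\mathbf n$. $\mathcal I\mathcal E^{\mathbf k}$ is the ideal of $\mathrm{NSym}^{(\ell)}$ generated by $(\bar\zeta_{\mathcal Q})_{\mathbf n}-(\zeta_{\mathcal Q})_{\mathbf n}$ for $\mathbf n\le\mathbf k$ (subscript = restriction to degree $\mathbf n$). $\mathcal E^{\mathbf k}$ is the largest graded subcoalgebra $C$ of $\mathrm{QSym}^{(\ell)}$ with $\bar\zeta_{\mathcal Q}(h)=\zeta_{\mathcal Q}(h)$ for all $h\in C$ of degree $\le\mathbf k$. *)

theory Defs
  imports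
    "HOL-Library.Poly_Mapping"
    "HOL-Library.Function_Algebras"
    "HOL-Library.Extended_Nat"
    "HOL-Library.FuncSet"
    "HOL-Algebra.Ideal"
begin

text \<open>
  The number of colours is the cardinality of the finite index type \<open>'l\<close>; elements of
  \<open>\<nat>\<^sup>\<ell>\<close> are functions \<open>'l \<Rightarrow> nat\<close> with the pointwise order, addition and zero.
  A monomial in the variables \<open>x\<^sub>j\<^sup>(\<^sup>i\<^sup>)\<close> is its finitely supported exponent function
  \<open>nat \<times> 'l \<Rightarrow>\<^sub>0 nat\<close>, and a power series is its coefficient function.
\<close>

type_synonym 'l mdeg = "'l \<Rightarrow> nat"
type_synonym 'l monomial = "(nat \<times> 'l) \<Rightarrow>\<^sub>0 nat"
type_synonym 'l pseries = "'l monomial \<Rightarrow> rat"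

definition tdeg :: "('l::finite) mdeg \<Rightarrow> nat" where
  "tdeg n = (\<Sum>i\<in>UNIV. n i)"

definition mdeg_le :: "'l mdeg \<Rightarrow> ('l \<Rightarrow> enat) \<Rightarrow> bool" where
  "mdeg_le n k \<longleftrightarrow> (\<lambda>i. enat (n i)) \<le> k"

definition scl :: "rat \<Rightarrow> ('a \<Rightarrow> rat) \<Rightarrow> 'a \<Rightarrow> rat" where
  "scl c f = (\<lambda>x. c * f x)"

global_interpretation fvs: vector_space scl
  by unfold_locales (auto simp: scl_def fun_eq_iff algebra_simps)

subsection \<open>Quasisymmetric functions\<close>

definition vcomps :: "('l mdeg) list set" where
  "vcomps = {I. \<forall>n\<in>set I. n \<noteq> 0}"

definition xmon :: "nat \<Rightarrow> ('l::finite) mdeg \<Rightarrow> 'l monomial" where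
  "xmon j n = (\<Sum>i\<in>UNIV. Poly_Mapping.single (j, i) (n i))"

text \<open>
  The coefficient of a monomial in \<open>M I\<close> is the number of index sequences
  \<open>j\<^sub>1 < \<dots> < j\<^sub>m\<close> whose term in the defining infinite sum is that monomial.
\<close>

definition M :: "('l::finite) mdeg list \<Rightarrow> 'l pseries" where
  "M I a = of_nat (card {js. length js = length I \<and> sorted_wrt (<) js \<and>
                             sum_list (map2 xmon js I) = a})"

definition QSym :: "('l::finite) pseries set" where
  "QSym = fvs.span (M ` vcomps)"

definition mon_deg :: "'l monomial \<Rightarrow> 'l mdeg" where
  "mon_deg a = (\<lambda>i. Sum_any (\<lambda>j. Poly_Mapping.lookup a (j, i)))"

definition hcomp :: "'l mdeg \<Rightarrow> 'l pseries \<Rightarrow> 'l pseries" where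
  "hcomp n h = (\<lambda>a. if mon_deg a = n then h a else 0)"

definition homogeneous :: "'l mdeg \<Rightarrow> 'l pseries \<Rightarrow> bool" where
  "homogeneous n h \<longleftrightarrow> (\<forall>a. h a \<noteq> 0 \<longrightarrow> mon_deg a = n)"

definition Mcoeff :: "('l::finite) mdeg list \<Rightarrow> 'l pseries \<Rightarrow> rat" where
  "Mcoeff I h = fvs.representation (M ` vcomps) h (M I)"

text \<open>
  For spaces \<open>V\<close>, \<open>W\<close> of functions the tensor product \<open>V \<otimes> W\<close> is realised, via
  \<open>f \<otimes> g \<mapsto> (\<lambda>(a, b). f a * g b)\<close>, as a space of functions of two arguments.
\<close>

definition tensor :: "('a \<Rightarrow> rat) \<Rightarrow> ('b \<Rightarrow> rat) \<Rightarrow> 'a \<times> 'b \<Rightarrow> rat" where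
  "tensor f g = (\<lambda>(a, b). f a * g b)"

definition tensor_space :: "('a \<Rightarrow> rat) set \<Rightarrow> ('b \<Rightarrow> rat) set \<Rightarrow> ('a \<times> 'b \<Rightarrow> rat) set" where
  "tensor_space V W = fvs.span {tensor f g | f g. f \<in> V \<and> g \<in> W}"

definition coprod :: "('l::finite) pseries \<Rightarrow> 'l monomial \<times> 'l monomial \<Rightarrow> rat" where
  "coprod h = (\<Sum>I | I \<in> vcomps \<and> Mcoeff I h \<noteq> 0.
     scl (Mcoeff I h) (\<Sum>r\<le>length I. tensor (M (take r I)) (M (drop r I))))"

subsection \<open>The graded dual\<close>

definition NSym_carrier :: "(('l::finite) pseries \<Rightarrow> rat) set" where
  "NSym_carrier = {\<phi> \<in> extensional QSym.
     (\<forall>f\<in>QSym. \<forall>g\<in>QSym. \<phi> (f + g) = \<phi> f + \<phi> g) \<and>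
     (\<forall>c. \<forall>f\<in>QSym. \<phi> (scl c f) = c * \<phi> f) \<and>
     finite {n. \<exists>h\<in>QSym. homogeneous n h \<and> \<phi> h \<noteq> 0}}"

text \<open>
  If \<open>T = \<Sum> f\<^sub>s \<otimes> g\<^sub>s\<close> then \<open>\<lambda>b. T (a, b)\<close> is \<open>\<Sum> f\<^sub>s a \<cdot> g\<^sub>s\<close>, so for linear
  \<open>\<phi>\<close> and \<open>\<psi>\<close> this yields \<open>\<Sum> \<phi> f\<^sub>s * \<psi> g\<^sub>s\<close>.
\<close>

definition tensor_functional ::
  "(('a \<Rightarrow> rat) \<Rightarrow> rat) \<Rightarrow> (('b \<Rightarrow> rat) \<Rightarrow> rat) \<Rightarrow> ('a \<times> 'b \<Rightarrow> rat) \<Rightarrow> rat" where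
  "tensor_functional \<phi> \<psi> T = \<phi> (\<lambda>a. \<psi> (\<lambda>b. T (a, b)))"

definition Sdual :: "('l::finite) mdeg list \<Rightarrow> 'l pseries \<Rightarrow> rat" where
  "Sdual I = (\<lambda>h\<in>QSym. Mcoeff I h)"

definition NSym :: "(('l::finite) pseries \<Rightarrow> rat) ring" where
  "NSym = \<lparr>carrier = NSym_carrier,
           monoid.mult = (\<lambda>\<phi> \<psi>. \<lambda>h\<in>QSym. tensor_functional \<phi> \<psi> (coprod h)),
           one = Sdual [],
           zero = (\<lambda>h\<in>QSym. 0),
           add = (\<lambda>\<phi> \<psi>. \<lambda>h\<in>QSym. \<phi> h + \<psi> h)\<rparr>"

subsection \<open>Even ideals and even subcoalgebras\<close>

definition zeta :: "('l::finite) pseries \<Rightarrow> rat" where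
  "zeta = (\<lambda>h\<in>QSym. \<Sum>I | I \<in> vcomps \<and> Mcoeff I h \<noteq> 0.
             Mcoeff I h * (if length I \<le> 1 then 1 else 0))"

definition bar :: "(('l::finite) pseries \<Rightarrow> rat) \<Rightarrow> 'l pseries \<Rightarrow> rat" where
  "bar \<phi> = (\<lambda>h\<in>QSym. \<Sum>n | hcomp n h \<noteq> 0. (-1) ^ tdeg n * \<phi> (hcomp n h))"

definition deg_part :: "'l mdeg \<Rightarrow> (('l::finite) pseries \<Rightarrow> rat) \<Rightarrow> 'l pseries \<Rightarrow> rat" where
  "deg_part n \<phi> = (\<lambda>h\<in>QSym. \<phi> (hcomp n h))"

definition even_ideal :: "(('l::finite) \<Rightarrow> enat) \<Rightarrow> ('l pseries \<Rightarrow> rat) set" where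
  "even_ideal k = genideal NSym
     {deg_part n (bar zeta) \<ominus>\<^bsub>NSym\<^esub> deg_part n zeta | n. mdeg_le n k}"

definition graded_subcoalgebra :: "('l::finite) pseries set \<Rightarrow> bool" where
  "graded_subcoalgebra C \<longleftrightarrow> C \<subseteq> QSym \<and> fvs.subspace C \<and>
     (\<forall>h\<in>C. \<forall>n. hcomp n h \<in> C) \<and> coprod ` C \<subseteq> tensor_space C C"

definition even_subcoalgebra :: "(('l::finite) \<Rightarrow> enat) \<Rightarrow> 'l pseries set \<Rightarrow> bool" where
  "even_subcoalgebra k C \<longleftrightarrow> graded_subcoalgebra C \<and>
     (\<forall>n. mdeg_le n k \<longrightarrow> (\<forall>h\<in>C. homogeneous n h \<longrightarrow> bar zeta h = zeta h))"

definition even_subalgebra :: "(('l::finite) \<Rightarrow> enat) \<Rightarrow> 'l pseries set" where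
  "even_subalgebra k = (GREATEST C. even_subcoalgebra k C)"

subsection \<open>Well-definedness\<close>

lemma sum_apply: "(\<Sum>x\<in>A. f x) y = (\<Sum>x\<in>A. f x (y::'a)) " for f :: "'b \<Rightarrow> 'a \<Rightarrow> 'c::comm_monoid_add"
  by (induction A rule: infinite_finite_induct) auto

lemma lookup_xmon: "Poly_Mapping.lookup (xmon j n) (j', i) = (if j' = j then n i else 0)"
proof -
  have "Poly_Mapping.lookup (xmon j n) (j', i) =
        (\<Sum>i'\<in>UNIV. Poly_Mapping.lookup (Poly_Mapping.single (j, i') (n i')) (j', i))"
    unfolding xmon_def by (rule lookup_sum)
  also have "\<dots> = (\<Sum>i'\<in>UNIV. if i' = i then (if j' = j then n i else 0) else 0)"
    by (rule sum.cong) (auto simp: lookup_single when_def)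
  finally show ?thesis by simp
qed

lemma lookup_terms_notin:
  assumes "length js = length I" "j \<notin> set js"
  shows "Poly_Mapping.lookup (sum_list (map2 xmon js I)) (j, i) = 0"
  using assms by (induction js I rule: list_induct2) (auto simp: lookup_add lookup_xmon)

lemma lookup_terms_nth:
  assumes "length js = length I" "distinct js" "r < length js"
  shows "Poly_Mapping.lookup (sum_list (map2 xmon js I)) (js ! r, i) = (I ! r) i"
  using assms
proof (induction js I arbitrary: r rule: list_induct2)
  case (Cons j js n I)
  show ?case
  proof (cases r)
    case 0
    then show ?thesis using Cons by (auto simp: lookup_add lookup_xmon lookup_terms_notin)
  next
    case (Suc s)
    then have "js ! s \<noteq> j" using Cons by auto
    then show ?thesis using Cons Suc by (auto simp: lookup_add lookup_xmon)
  qed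
qed simp

lemma rows_terms:
  assumes "length js = length I" "distinct js" "I \<in> vcomps"
  shows "{j. \<exists>i. Poly_Mapping.lookup (sum_list (map2 xmon js I)) (j, i) \<noteq> 0} = set js"
proof (intro Set.set_eqI iffI)
  fix j assume "j \<in> {j. \<exists>i. Poly_Mapping.lookup (sum_list (map2 xmon js I)) (j, i) \<noteq> 0}"
  then show "j \<in> set js" using lookup_terms_notin[OF assms(1)] by fastforce
next
  fix j assume "j \<in> set js"
  then obtain r where r: "r < length js" "j = js ! r" by (auto simp: in_set_conv_nth)
  with assms have "I ! r \<noteq> 0" by (auto simp: vcomps_def)
  then obtain i where "(I ! r) i \<noteq> 0" by (auto simp: fun_eq_iff)
  then show "j \<in> {j. \<exists>i. Poly_Mapping.lookup (sum_list (map2 xmon js I)) (j, i) \<noteq> 0}"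
    using lookup_terms_nth[OF assms(1,2) r(1)] r(2) by force
qed

lemma terms_unique:
  assumes "length js = length I" "sorted_wrt (<) js" "I \<in> vcomps"
      and "length js' = length J" "sorted_wrt (<) js'" "J \<in> vcomps"
      and eq: "sum_list (map2 xmon js I) = sum_list (map2 xmon js' J)"
  shows "js = js' \<and> I = J"
proof -
  have d: "distinct js" "distinct js'" using assms(2,5) by (auto simp: strict_sorted_iff)
  have "set js = set js'"
    using rows_terms[OF assms(1) d(1) assms(3)] rows_terms[OF assms(4) d(2) assms(6)] eq by simp
  then have js: "js = js'" using assms(2,5) by (metis strict_sorted_equal)
  moreover have "I = J"
  proof (rule nth_equalityI)
    show "length I = length J" using js assms by simp
    fix r assume "r < length I"
    then show "I ! r = J ! r"
      using lookup_terms_nth[OF assms(1) d(1)] lookup_terms_nth[OF assms(4) d(2)] js eq assms(1,4)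
      by (intro HOL.ext) (metis (no_types))
  qed
  ultimately show ?thesis by simp
qed

definition lmon :: "('l::finite) mdeg list \<Rightarrow> 'l monomial" where
  "lmon I = sum_list (map2 xmon [0..<length I] I)"

lemma M_lmon:
  assumes "I \<in> vcomps" "J \<in> vcomps"
  shows "M I (lmon J) = (if I = J then 1 else 0)"
proof -
  let ?A = "{js. length js = length I \<and> sorted_wrt (<) js \<and> sum_list (map2 xmon js I) = lmon J}"
  have sub: "js = [0..<length J] \<and> I = J" if "js \<in> ?A" for js
  proof (rule terms_unique)
    show "length js = length I" "sorted_wrt (<) js" "I \<in> vcomps" "J \<in> vcomps"
      using that assms by simp_all
    show "sum_list (map2 xmon js I) = sum_list (map2 xmon [0..<length J] J)"
      using that by (simp add: lmon_def)
  qed simp_all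
  show ?thesis
  proof (cases "I = J")
    case True
    have "[0..<length J] \<in> ?A" using True by (simp add: lmon_def)
    then have "?A = {[0..<length J]}" using sub by blast
    then show ?thesis using True unfolding M_def by simp
  next
    case False
    then have "?A = {}" using sub by blast
    then have "card ?A = 0" by (simp only: card.empty)
    then show ?thesis unfolding M_def using False by simp
  qed
qed

lemma inj_M: "inj_on M vcomps"
proof (rule inj_onI)
  fix I J :: "'a mdeg list" assume "I \<in> vcomps" "J \<in> vcomps" "M I = M J"
  then show "I = J" using M_lmon[of I J] M_lmon[of J J] by (metis zero_neq_one)
qed

lemma independent_M: "fvs.independent (M ` (vcomps :: ('l::finite) mdeg list set))"
proof
  assume "fvs.dependent (M ` (vcomps :: 'l mdeg list set))"
  then obtain t u where t: "finite t" "t \<subseteq> M ` (vcomps :: 'l mdeg list set)"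
    "(\<Sum>v\<in>t. scl (u v) v) = 0" "\<exists>v\<in>t. u v \<noteq> 0"
    unfolding fvs.dependent_explicit by blast
  then obtain I where I: "I \<in> vcomps" "M I \<in> t" "u (M I) \<noteq> 0" by auto
  have "0 = (\<Sum>v\<in>t. scl (u v) v) (lmon I)" using t(3) by simp
  also have "\<dots> = (\<Sum>v\<in>t. u v * v (lmon I))" by (simp add: sum_apply scl_def)
  also have "\<dots> = (\<Sum>v\<in>t. if v = M I then u v else 0)"
  proof (intro sum.cong refl)
    fix v assume "v \<in> t"
    then obtain J where "J \<in> vcomps" "v = M J" using t(2) by blast
    then show "u v * v (lmon I) = (if v = M I then u v else 0)"
      using I(1) M_lmon[of J I] M_lmon[of I I] by auto
  qed
  also have "\<dots> = u (M I)" using t(1) I(2) by simp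
  finally show False using I(3) by simp
qed

lemma M_in_QSym: "I \<in> vcomps \<Longrightarrow> M I \<in> QSym"
  unfolding QSym_def by (auto intro: fvs.span_base)

lemma subspace_QSym: "fvs.subspace QSym"
  unfolding QSym_def by (rule fvs.subspace_span)

lemma Mcoeff_eq:
  assumes "h \<in> QSym" "I \<in> vcomps"
  shows "Mcoeff I h = h (lmon I)"
proof -
  let ?r = "fvs.representation (M ` vcomps) h"
  have h: "(\<Sum>b | ?r b \<noteq> 0. scl (?r b) b) = h"
    by (rule fvs.sum_nonzero_representation_eq[OF independent_M assms(1)[unfolded QSym_def]])
  have "h (lmon I) = (\<Sum>b | ?r b \<noteq> 0. scl (?r b) b) (lmon I)" using h by simp
  also have "\<dots> = (\<Sum>b | ?r b \<noteq> 0. ?r b * b (lmon I))" by (simp add: sum_apply scl_def)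
  also have "\<dots> = (\<Sum>b | ?r b \<noteq> 0. if b = M I then ?r b else 0)"
  proof (intro sum.cong refl)
    fix b assume "b \<in> {b. ?r b \<noteq> 0}"
    then obtain J where "J \<in> vcomps" "b = M J" using fvs.representation_ne_zero by blast
    then show "?r b * b (lmon I) = (if b = M I then ?r b else 0)"
      using assms(2) M_lmon[of J I] M_lmon[of I I] by auto
  qed
  also have "\<dots> = ?r (M I)"
    using fvs.finite_representation[of "M ` vcomps" h] by (simp add: sum.delta)
  finally show ?thesis by (simp add: Mcoeff_def)
qed

lemma QSym_expand:
  assumes "h \<in> QSym"
  shows "finite {I. I \<in> vcomps \<and> Mcoeff I h \<noteq> 0}"
    and "h = (\<Sum>I | I \<in> vcomps \<and> Mcoeff I h \<noteq> 0. scl (Mcoeff I h) (M I))"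
proof -
  let ?r = "fvs.representation (M ` vcomps) h"
  let ?A = "{I. I \<in> vcomps \<and> Mcoeff I h \<noteq> 0}"
  have im: "M ` ?A = {b. ?r b \<noteq> 0}"
    using fvs.representation_ne_zero[of "M ` vcomps" h] by (fastforce simp: Mcoeff_def)
  have inj: "inj_on M ?A" using inj_M by (rule inj_on_subset) auto
  show "finite ?A"
    using fvs.finite_representation[of "M ` vcomps" h] im finite_image_iff[OF inj] by simp
  have "h = (\<Sum>b | ?r b \<noteq> 0. scl (?r b) b)"
    by (rule fvs.sum_nonzero_representation_eq[OF independent_M assms[unfolded QSym_def], symmetric])
  also have "\<dots> = (\<Sum>I\<in>?A. scl (?r (M I)) (M I))"
    unfolding im[symmetric] using sum.reindex[OF inj, of "\<lambda>b. scl (?r b) b"] by (simp add: comp_def)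
  finally show "h = (\<Sum>I\<in>?A. scl (Mcoeff I h) (M I))" by (simp add: Mcoeff_def)
qed

lemma QSym_add: "f \<in> QSym \<Longrightarrow> g \<in> QSym \<Longrightarrow> f + g \<in> QSym"
  and QSym_scl: "f \<in> QSym \<Longrightarrow> scl c f \<in> QSym"
  and QSym_0: "0 \<in> QSym"
  by (rule fvs.subspace_add[OF subspace_QSym] fvs.subspace_scale[OF subspace_QSym]
      fvs.subspace_0[OF subspace_QSym]; assumption)+

lemma Mcoeff_add: "f \<in> QSym \<Longrightarrow> g \<in> QSym \<Longrightarrow> I \<in> vcomps \<Longrightarrow> Mcoeff I (f + g) = Mcoeff I f + Mcoeff I g"
  and Mcoeff_scl: "f \<in> QSym \<Longrightarrow> I \<in> vcomps \<Longrightarrow> Mcoeff I (scl c f) = c * Mcoeff I f"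
  by (simp_all add: Mcoeff_eq QSym_add QSym_scl) (simp add: scl_def)

lemma Mcoeff_M: "I \<in> vcomps \<Longrightarrow> J \<in> vcomps \<Longrightarrow> Mcoeff I (M J) = (if I = J then 1 else 0)"
  by (auto simp: Mcoeff_eq M_in_QSym M_lmon)

lemma QSym_induct [consumes 1, case_names zero step]:
  assumes "h \<in> QSym" and "P 0"
    and "\<And>c I h. I \<in> vcomps \<Longrightarrow> h \<in> QSym \<Longrightarrow> P h \<Longrightarrow> P (scl c (M I) + h)"
  shows "P h"
proof -
  have "h \<in> QSym \<and> P h" using assms(1)[unfolded QSym_def]
  proof (induction rule: fvs.span_induct_alt)
    case base show ?case using assms(2) QSym_0 by (simp add: zero_fun_def)
  next
    case (step c x y)
    then show ?case using assms(3) QSym_add QSym_scl M_in_QSym by blast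
  qed
  then show ?thesis ..
qed

lemma coprod_M:
  assumes "I \<in> vcomps"
  shows "coprod (M I) = (\<Sum>r\<le>length I. tensor (M (take r I)) (M (drop r I)))"
proof -
  have "{J. J \<in> vcomps \<and> Mcoeff J (M I) \<noteq> 0} = {I}" using assms by (auto simp: Mcoeff_M split: if_splits)
  then show ?thesis using assms by (simp add: coprod_def Mcoeff_M)
qed

lemma coprod_superset:
  assumes "h \<in> QSym" "finite A" "A \<subseteq> vcomps" "{I. I \<in> vcomps \<and> Mcoeff I h \<noteq> 0} \<subseteq> A"
  shows "coprod h = (\<Sum>I\<in>A. scl (Mcoeff I h) (\<Sum>r\<le>length I. tensor (M (take r I)) (M (drop r I))))"
  unfolding coprod_def using assms by (intro sum.mono_neutral_left) auto

lemma coprod_add: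
  assumes "f \<in> QSym" "g \<in> QSym"
  shows "coprod (f + g) = coprod f + coprod g"
proof -
  let ?S = "\<lambda>h. {I. I \<in> vcomps \<and> Mcoeff I h \<noteq> 0}"
  let ?A = "?S f \<union> ?S g"
  have A: "finite ?A" "?A \<subseteq> vcomps" using QSym_expand(1) assms by auto
  have "?S (f + g) \<subseteq> ?A" using Mcoeff_add[OF assms] by auto
  note sup = coprod_superset[where A = ?A, OF _ A]
  let ?D = "\<lambda>I. \<Sum>r\<le>length I. tensor (M (take r I)) (M (drop r I))"
  have "coprod (f + g) = (\<Sum>I\<in>?A. scl (Mcoeff I (f + g)) (?D I))"
    by (rule sup[OF QSym_add[OF assms] \<open>?S (f + g) \<subseteq> ?A\<close>])
  also have "\<dots> = (\<Sum>I\<in>?A. scl (Mcoeff I f) (?D I) + scl (Mcoeff I g) (?D I))"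
    using assms by (intro sum.cong refl) (auto simp only: Mcoeff_add fvs.scale_left_distrib)
  also have "\<dots> = (\<Sum>I\<in>?A. scl (Mcoeff I f) (?D I)) + (\<Sum>I\<in>?A. scl (Mcoeff I g) (?D I))"
    by (rule sum.distrib)
  also have "\<dots> = coprod f + coprod g"
    using sup[OF assms(1)] sup[OF assms(2)] by simp
  finally show ?thesis .
qed

lemma coprod_scl:
  assumes "f \<in> QSym"
  shows "coprod (scl c f) = scl c (coprod f)"
proof -
  let ?S = "\<lambda>h. {I. I \<in> vcomps \<and> Mcoeff I h \<noteq> 0}"
  have A: "finite (?S f)" "?S f \<subseteq> vcomps" using QSym_expand(1) assms by auto
  have "?S (scl c f) \<subseteq> ?S f" using Mcoeff_scl[OF assms] by auto
  then have "coprod (scl c f) = (\<Sum>I\<in>?S f. scl (Mcoeff I (scl c f))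
      (\<Sum>r\<le>length I. tensor (M (take r I)) (M (drop r I))))"
    using coprod_superset[OF QSym_scl[OF assms] A] by blast
  also have "\<dots> = (\<Sum>I\<in>?S f. scl c (scl (Mcoeff I f)
      (\<Sum>r\<le>length I. tensor (M (take r I)) (M (drop r I)))))"
    using assms by (intro sum.cong refl) (auto simp only: Mcoeff_scl fvs.scale_scale)
  finally show ?thesis by (simp add: coprod_def fvs.scale_sum_right)
qed

lemma mon_deg_add: "mon_deg (a + b) = mon_deg a + mon_deg b"
proof
  fix i
  have fin: "finite {j. Poly_Mapping.lookup c (j, i) \<noteq> 0}" for c :: "'a monomial"
    by (rule finite_subset[of _ "fst ` Poly_Mapping.keys c"]) (force simp: in_keys_iff)+
  show "mon_deg (a + b) i = (mon_deg a + mon_deg b) i"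
    unfolding mon_deg_def lookup_add plus_fun_apply by (rule Sum_any.distrib) (rule fin)+
qed

lemma mon_deg_0: "mon_deg 0 = 0"
  by (simp add: mon_deg_def fun_eq_iff)

lemma mon_deg_xmon: "mon_deg (xmon j n) = n"
proof
  fix i
  have "mon_deg (xmon j n) i = Sum_any (\<lambda>j'. if j' = j then n i else 0)"
    by (simp add: mon_deg_def lookup_xmon)
  also have "\<dots> = n i" using Sum_any.delta[of j "\<lambda>_. n i"] by (simp add: when_def)
  finally show "mon_deg (xmon j n) i = n i" .
qed

lemma mon_deg_terms:
  "length js = length I \<Longrightarrow> mon_deg (sum_list (map2 xmon js I)) = sum_list I"
  by (induction js I rule: list_induct2) (simp_all add: mon_deg_add mon_deg_0 mon_deg_xmon)

lemma homogeneous_M: "homogeneous (sum_list I) (M I)"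
  unfolding homogeneous_def
proof (intro allI impI)
  fix a assume "M I a \<noteq> 0"
  then have "card {js. length js = length I \<and> sorted_wrt (<) js \<and>
                       sum_list (map2 xmon js I) = a} \<noteq> 0"
    unfolding M_def by (simp only: of_nat_eq_0_iff not_False_eq_True)
  then have "{js. length js = length I \<and> sorted_wrt (<) js \<and>
                  sum_list (map2 xmon js I) = a} \<noteq> {}"
    by (metis card.empty)
  then obtain js where "length js = length I" "sum_list (map2 xmon js I) = a" by blast
  then show "mon_deg a = sum_list I" using mon_deg_terms by blast
qed

lemma hcomp_homogeneous: "homogeneous m h \<Longrightarrow> hcomp n h = (if n = m then h else 0)"
  by (fastforce simp: homogeneous_def hcomp_def fun_eq_iff)

lemma homogeneous_hcomp: "homogeneous n (hcomp n h)"
  by (auto simp: homogeneous_def hcomp_def)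

lemma hcomp_add: "hcomp n (f + g) = hcomp n f + hcomp n g"
  and hcomp_scl: "hcomp n (scl c f) = scl c (hcomp n f)"
  and hcomp_0: "hcomp n 0 = 0"
  by (auto simp: hcomp_def scl_def fun_eq_iff)

lemma hcomp_QSym: "h \<in> QSym \<Longrightarrow> hcomp n h \<in> QSym"
proof (induction rule: QSym_induct)
  case zero
  then show ?case by (simp only: hcomp_0 QSym_0)
next
  case (step c I h)
  then show ?case
    by (simp only: hcomp_add hcomp_scl hcomp_homogeneous[OF homogeneous_M])
       (auto intro!: QSym_add QSym_scl simp: M_in_QSym QSym_0 simp del: plus_fun_apply zero_fun_apply)
qed

lemma lmon_deg: "mon_deg (lmon I) = sum_list I"
  unfolding lmon_def by (rule mon_deg_terms) simp

lemma Mcoeff_homogeneous: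
  "h \<in> QSym \<Longrightarrow> homogeneous n h \<Longrightarrow> I \<in> vcomps \<Longrightarrow> Mcoeff I h \<noteq> 0 \<Longrightarrow> sum_list I = n"
  by (auto simp: Mcoeff_eq homogeneous_def lmon_deg[symmetric])

definition qlinear :: "(('l::finite) pseries \<Rightarrow> rat) \<Rightarrow> bool" where
  "qlinear \<phi> \<longleftrightarrow> (\<forall>f\<in>QSym. \<forall>g\<in>QSym. \<phi> (f + g) = \<phi> f + \<phi> g) \<and>
     (\<forall>c. \<forall>f\<in>QSym. \<phi> (scl c f) = c * \<phi> f)"

lemma qlinear_add: "qlinear \<phi> \<Longrightarrow> f \<in> QSym \<Longrightarrow> g \<in> QSym \<Longrightarrow> \<phi> (f + g) = \<phi> f + \<phi> g"
  and qlinear_scl: "qlinear \<phi> \<Longrightarrow> f \<in> QSym \<Longrightarrow> \<phi> (scl c f) = c * \<phi> f"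
  by (auto simp: qlinear_def)

lemma qlinear_0: "qlinear \<phi> \<Longrightarrow> \<phi> 0 = 0"
  using qlinear_scl[of \<phi> 0 0] QSym_0 by (simp add: fvs.scale_zero_left)

lemma qlinear_sum:
  assumes "qlinear \<phi>" "\<And>x. x \<in> A \<Longrightarrow> f x \<in> QSym"
  shows "\<phi> (\<Sum>x\<in>A. f x) = (\<Sum>x\<in>A. \<phi> (f x))"
  using assms(2)
proof (induction A rule: infinite_finite_induct)
  case (insert x A)
  have "(\<Sum>x\<in>A. f x) \<in> QSym" using insert.prems by (intro fvs.subspace_sum[OF subspace_QSym]) auto
  then have "\<phi> (f x + (\<Sum>x\<in>A. f x)) = \<phi> (f x) + \<phi> (\<Sum>x\<in>A. f x)"
    using insert.prems by (intro qlinear_add[OF assms(1)]) auto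
  then show ?case using insert by (simp del: plus_fun_apply)
qed (simp_all add: qlinear_0[OF assms(1)] del: zero_fun_apply)

lemma qlinear_expand:
  assumes "qlinear \<phi>" "h \<in> QSym"
  shows "\<phi> h = (\<Sum>I | I \<in> vcomps \<and> Mcoeff I h \<noteq> 0. Mcoeff I h * \<phi> (M I))"
proof -
  have "\<phi> h = \<phi> (\<Sum>I | I \<in> vcomps \<and> Mcoeff I h \<noteq> 0. scl (Mcoeff I h) (M I))"
    using QSym_expand(2)[OF assms(2)] by (rule arg_cong)
  also have "\<dots> = (\<Sum>I | I \<in> vcomps \<and> Mcoeff I h \<noteq> 0. \<phi> (scl (Mcoeff I h) (M I)))"
    by (rule qlinear_sum[OF assms(1)]) (auto intro: QSym_scl M_in_QSym)
  also have "\<dots> = (\<Sum>I | I \<in> vcomps \<and> Mcoeff I h \<noteq> 0. Mcoeff I h * \<phi> (M I))"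
    by (intro sum.cong refl qlinear_scl[OF assms(1)] M_in_QSym) simp
  finally show ?thesis .
qed

lemma qlinear_combination:
  assumes "\<And>h. h \<in> QSym \<Longrightarrow> \<phi> h = (\<Sum>I | I \<in> vcomps \<and> Mcoeff I h \<noteq> 0. Mcoeff I h * F I)"
  shows "qlinear \<phi>" and "I \<in> vcomps \<Longrightarrow> \<phi> (M I) = F I"
proof -
  let ?S = "\<lambda>h. {I. I \<in> vcomps \<and> Mcoeff I h \<noteq> 0}"
  have sup: "\<phi> h = (\<Sum>I\<in>A. Mcoeff I h * F I)"
    if "h \<in> QSym" "finite A" "A \<subseteq> vcomps" "?S h \<subseteq> A" for h A
    unfolding assms[OF that(1)] using that by (intro sum.mono_neutral_left) auto
  show "qlinear \<phi>" unfolding qlinear_def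
  proof (intro conjI ballI allI)
    fix f g :: "'a pseries" assume fg: "f \<in> QSym" "g \<in> QSym"
    let ?A = "?S f \<union> ?S g"
    have A: "finite ?A" "?A \<subseteq> vcomps" using QSym_expand(1) fg by auto
    have "?S (f + g) \<subseteq> ?A" using Mcoeff_add[OF fg] by auto
    from sup[OF QSym_add[OF fg] A this]
    have "\<phi> (f + g) = (\<Sum>I\<in>?A. Mcoeff I f * F I + Mcoeff I g * F I)"
      using fg by (simp only:) (intro sum.cong refl, auto simp only: Mcoeff_add distrib_right)
    also have "\<dots> = \<phi> f + \<phi> g"
      unfolding sum.distrib using sup[OF fg(1) A] sup[OF fg(2) A] by simp
    finally show "\<phi> (f + g) = \<phi> f + \<phi> g" .
  next
    fix c and f :: "'a pseries" assume f: "f \<in> QSym"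
    have A: "finite (?S f)" "?S f \<subseteq> vcomps" using QSym_expand(1) f by auto
    have "?S (scl c f) \<subseteq> ?S f" using Mcoeff_scl[OF f] by auto
    from sup[OF QSym_scl[OF f] A this]
    have "\<phi> (scl c f) = (\<Sum>I\<in>?S f. c * (Mcoeff I f * F I))"
      using f by (simp only:) (intro sum.cong refl, auto simp only: Mcoeff_scl mult.assoc)
    then show "\<phi> (scl c f) = c * \<phi> f"
      using assms[OF f] by (simp add: sum_distrib_left)
  qed
  assume I: "I \<in> vcomps"
  then have "?S (M I) = {I}" by (auto simp: Mcoeff_M split: if_splits)
  then show "\<phi> (M I) = F I" using assms[OF M_in_QSym[OF I]] I by (simp add: Mcoeff_M)
qed

lemma zeta_expand:
  "h \<in> QSym \<Longrightarrow> zeta h = (\<Sum>I | I \<in> vcomps \<and> Mcoeff I h \<noteq> 0.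
     Mcoeff I h * (if length I \<le> 1 then 1 else 0))"
  by (simp add: zeta_def)

lemma qlinear_zeta: "qlinear zeta"
  using zeta_expand by (rule qlinear_combination(1))

lemma zeta_M: "I \<in> vcomps \<Longrightarrow> zeta (M I) = (if length I \<le> 1 then 1 else 0)"
  using zeta_expand by (rule qlinear_combination(2))

lemma bar_homogeneous:
  assumes "qlinear \<phi>" "h \<in> QSym" "homogeneous n h"
  shows "bar \<phi> h = (-1) ^ tdeg n * \<phi> h"
proof (cases "h = 0")
  case True
  then have "{m. hcomp m h \<noteq> 0} = {}" by (simp only: hcomp_0) simp
  then show ?thesis using assms True qlinear_0[OF assms(1)] by (simp only: bar_def restrict_apply') simp
next
  case False
  then have "{m. hcomp m h \<noteq> 0} = {n}" by (auto simp: hcomp_homogeneous[OF assms(3)])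
  then show ?thesis using assms hcomp_homogeneous[OF assms(3), of n] by (simp add: bar_def)
qed

lemma tensor_functional_slices:
  fixes T :: "('l::finite) monomial \<times> 'l monomial \<Rightarrow> rat"
  assumes "T \<in> tensor_space QSym QSym" "qlinear \<psi>"
  shows "(\<lambda>b. T (a, b)) \<in> QSym" and "(\<lambda>a. \<psi> (\<lambda>b. T (a, b))) \<in> QSym"
proof -
  have "(\<forall>a. (\<lambda>b. T (a, b)) \<in> QSym) \<and> (\<lambda>a. \<psi> (\<lambda>b. T (a, b))) \<in> QSym"
    using assms(1) unfolding tensor_space_def
  proof (induction rule: fvs.span_induct_alt)
    case base
    show ?case
      using QSym_0[unfolded zero_fun_def] qlinear_0[OF assms(2), unfolded zero_fun_def] by simp
  next
    case (step c x y)
    then obtain f g where fg: "x = tensor f g" "f \<in> QSym" "g \<in> QSym" by blast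
    have e: "(\<lambda>b. (scl c x + y) (a, b)) = scl (c * f a) g + (\<lambda>b. y (a, b))" for a
      by (auto simp: fg(1) tensor_def scl_def fun_eq_iff)
    have "\<psi> (\<lambda>b. (scl c x + y) (a, b)) = (c * f a) * \<psi> g + \<psi> (\<lambda>b. y (a, b))" for a
      unfolding e using step fg assms(2)
      by (subst qlinear_add) (auto simp: qlinear_scl intro: QSym_scl)
    then have e2: "(\<lambda>a. \<psi> (\<lambda>b. (scl c x + y) (a, b))) = scl (c * \<psi> g) f + (\<lambda>a. \<psi> (\<lambda>b. y (a, b)))"
      by (auto simp: scl_def fun_eq_iff)
    show ?case unfolding e2 unfolding e using step fg by (blast intro: QSym_add QSym_scl)
  qed
  then show "(\<lambda>b. T (a, b)) \<in> QSym" "(\<lambda>a. \<psi> (\<lambda>b. T (a, b))) \<in> QSym" by blast+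
qed

lemma tensor_functional_tensor:
  assumes "qlinear \<phi>" "qlinear \<psi>" "f \<in> QSym" "g \<in> QSym"
  shows "tensor_functional \<phi> \<psi> (tensor f g) = \<phi> f * \<psi> g"
proof -
  have "\<psi> (\<lambda>b. tensor f g (a, b)) = \<psi> g * f a" for a
    using qlinear_scl[OF assms(2,4), of "f a"] by (simp add: scl_def tensor_def)
  then show ?thesis
    using qlinear_scl[OF assms(1,3), of "\<psi> g"] by (simp add: tensor_functional_def scl_def)
qed

lemma tensor_functional_add:
  fixes T :: "('l::finite) monomial \<times> 'l monomial \<Rightarrow> rat"
  assumes "qlinear \<phi>" "qlinear \<psi>" "T \<in> tensor_space QSym QSym" "U \<in> tensor_space QSym QSym"
  shows "tensor_functional \<phi> \<psi> (T + U) = tensor_functional \<phi> \<psi> T + tensor_functional \<phi> \<psi> U"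
proof -
  note s = tensor_functional_slices[OF assms(3,2)] tensor_functional_slices[OF assms(4,2)]
  have e: "(\<lambda>b. (T + U) (a, b)) = (\<lambda>b. T (a, b)) + (\<lambda>b. U (a, b))" for a
    by (simp add: fun_eq_iff)
  have "(\<lambda>a. \<psi> (\<lambda>b. (T + U) (a, b))) = (\<lambda>a. \<psi> (\<lambda>b. T (a, b))) + (\<lambda>a. \<psi> (\<lambda>b. U (a, b)))"
    unfolding e qlinear_add[OF assms(2) s(1) s(3)] by (simp add: fun_eq_iff)
  then show ?thesis unfolding tensor_functional_def using qlinear_add[OF assms(1) s(2) s(4)] by simp
qed

lemma tensor_functional_scl:
  fixes T :: "('l::finite) monomial \<times> 'l monomial \<Rightarrow> rat"
  assumes "qlinear \<phi>" "qlinear \<psi>" "T \<in> tensor_space QSym QSym"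
  shows "tensor_functional \<phi> \<psi> (scl c T) = c * tensor_functional \<phi> \<psi> T"
proof -
  note s = tensor_functional_slices[OF assms(3,2)]
  have e: "(\<lambda>b. (scl c T) (a, b)) = scl c (\<lambda>b. T (a, b))" for a
    by (simp add: fun_eq_iff scl_def)
  have "(\<lambda>a. \<psi> (\<lambda>b. (scl c T) (a, b))) = scl c (\<lambda>a. \<psi> (\<lambda>b. T (a, b)))"
    unfolding e qlinear_scl[OF assms(2) s(1)] by (simp add: fun_eq_iff scl_def)
  then show ?thesis unfolding tensor_functional_def using qlinear_scl[OF assms(1) s(2)] by simp
qed

lemma subspace_tensor_space: "fvs.subspace (tensor_space V W)"
  unfolding tensor_space_def by (rule fvs.subspace_span)

lemma vcomps_take: "I \<in> vcomps \<Longrightarrow> take r I \<in> vcomps"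
  and vcomps_drop: "I \<in> vcomps \<Longrightarrow> drop r I \<in> vcomps"
  by (auto simp: vcomps_def dest: in_set_takeD in_set_dropD)

lemma coprod_M_tensor:
  assumes "I \<in> vcomps"
  shows "coprod (M I) \<in> tensor_space QSym QSym"
  unfolding coprod_M[OF assms]
proof (rule fvs.subspace_sum[OF subspace_tensor_space])
  fix r
  have "M (take r I) \<in> QSym" "M (drop r I) \<in> QSym"
    using assms by (auto intro: M_in_QSym vcomps_take vcomps_drop)
  then show "tensor (M (take r I)) (M (drop r I)) \<in> tensor_space QSym QSym"
    unfolding tensor_space_def by (intro fvs.span_base) blast
qed

lemma coprod_0: "coprod 0 = 0"
  using coprod_scl[OF QSym_0, of 0] by (simp only: fvs.scale_zero_left)

lemma coprod_QSym: "h \<in> QSym \<Longrightarrow> coprod h \<in> tensor_space QSym QSym"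
proof (induction rule: QSym_induct)
  case zero
  show ?case unfolding coprod_0 by (rule fvs.subspace_0[OF subspace_tensor_space])
next
  case (step c I h)
  then have "coprod (scl c (M I) + h) = scl c (coprod (M I)) + coprod h"
    by (simp only: coprod_add coprod_scl QSym_scl M_in_QSym)
  then show ?case
    using step coprod_M_tensor fvs.subspace_add[OF subspace_tensor_space]
      fvs.subspace_scale[OF subspace_tensor_space] by metis
qed

lemma NSym_carrierD:
  assumes "\<phi> \<in> carrier NSym"
  shows "qlinear \<phi>" "\<phi> \<in> extensional QSym" "finite {sum_list I | I. I \<in> vcomps \<and> \<phi> (M I) \<noteq> 0}"
proof -
  show "qlinear \<phi>" "\<phi> \<in> extensional QSym"
    using assms unfolding NSym_def NSym_carrier_def partial_object.simps qlinear_def mem_Collect_eq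
    by blast+
  have "finite {n. \<exists>h\<in>QSym. homogeneous n h \<and> \<phi> h \<noteq> 0}"
    using assms by (simp only: NSym_def NSym_carrier_def partial_object.simps mem_Collect_eq)
  then show "finite {sum_list I | I. I \<in> vcomps \<and> \<phi> (M I) \<noteq> 0}"
    by (rule rev_finite_subset) (use homogeneous_M M_in_QSym in blast)
qed

lemma NSym_carrierI:
  assumes "qlinear \<phi>" "\<phi> \<in> extensional QSym" "finite {sum_list I | I. I \<in> vcomps \<and> \<phi> (M I) \<noteq> 0}"
  shows "\<phi> \<in> carrier NSym"
proof -
  have "n \<in> {sum_list I | I. I \<in> vcomps \<and> \<phi> (M I) \<noteq> 0}"
    if "h \<in> QSym" "homogeneous n h" "\<phi> h \<noteq> 0" for h n
  proof -
    have "\<exists>I\<in>{I. I \<in> vcomps \<and> Mcoeff I h \<noteq> 0}. Mcoeff I h * \<phi> (M I) \<noteq> 0"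
      using that(3) qlinear_expand[OF assms(1) that(1)] by (metis (no_types, lifting) sum.neutral)
    then show ?thesis using Mcoeff_homogeneous[OF that(1,2)] by force
  qed
  then have "finite {n. \<exists>h\<in>QSym. homogeneous n h \<and> \<phi> h \<noteq> 0}"
    by (intro finite_subset[OF _ assms(3)]) blast
  then show ?thesis using assms(1,2)
    by (simp only: NSym_def NSym_carrier_def partial_object.simps mem_Collect_eq qlinear_def) blast
qed

lemma NSym_eqI:
  assumes "\<phi> \<in> carrier NSym" "\<psi> \<in> carrier NSym" "\<And>I. I \<in> vcomps \<Longrightarrow> \<phi> (M I) = \<psi> (M I)"
  shows "\<phi> = \<psi>"
proof (rule extensionalityI)
  fix h :: "'a pseries" assume h: "h \<in> QSym"
  show "\<phi> h = \<psi> h"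
    unfolding qlinear_expand[OF NSym_carrierD(1)[OF assms(1)] h]
      qlinear_expand[OF NSym_carrierD(1)[OF assms(2)] h]
    using assms(3) by (intro sum.cong) auto
qed (use assms NSym_carrierD in blast)+

lemma NSym_mult_M:
  assumes "\<phi> \<in> carrier NSym" "\<psi> \<in> carrier NSym" "I \<in> vcomps"
  shows "(\<phi> \<otimes>\<^bsub>NSym\<^esub> \<psi>) (M I) = (\<Sum>r\<le>length I. \<phi> (M (take r I)) * \<psi> (M (drop r I)))"
proof -
  note lin = NSym_carrierD(1)[OF assms(1)] NSym_carrierD(1)[OF assms(2)]
  have Q: "M (take r I) \<in> QSym" "M (drop r I) \<in> QSym" for r
    using assms(3) by (auto intro: M_in_QSym vcomps_take vcomps_drop)
  have T: "tensor (M (take r I)) (M (drop r I)) \<in> tensor_space QSym QSym" for r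
    unfolding tensor_space_def using Q by (intro fvs.span_base) blast
  have 0: "tensor_functional \<phi> \<psi> 0 = 0"
    using tensor_functional_scl[OF lin fvs.subspace_0[OF subspace_tensor_space], of 0]
    by (simp only: fvs.scale_zero_left mult_zero_left)
  have "tensor_functional \<phi> \<psi> (\<Sum>r\<in>A. tensor (M (take r I)) (M (drop r I))) =
        (\<Sum>r\<in>A. \<phi> (M (take r I)) * \<psi> (M (drop r I)))" if "finite A" for A
    using that
  proof induction
    case empty
    show ?case using 0 by (simp only: sum.empty)
  next
    case (insert r A)
    have "(\<Sum>r\<in>A. tensor (M (take r I)) (M (drop r I))) \<in> tensor_space QSym QSym"
      by (rule fvs.subspace_sum[OF subspace_tensor_space]) (rule T)
    from tensor_functional_add[OF lin T this, of r] show ?case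
      using insert by (simp add: tensor_functional_tensor[OF lin Q] del: plus_fun_apply)
  qed
  then show ?thesis
    using M_in_QSym[OF assms(3)] by (simp add: NSym_def coprod_M[OF assms(3)])
qed

lemma NSym_add_apply: "h \<in> QSym \<Longrightarrow> (\<phi> \<oplus>\<^bsub>NSym\<^esub> \<psi>) h = \<phi> h + \<psi> h"
  by (simp add: NSym_def)

lemma NSym_zero_apply: "h \<in> QSym \<Longrightarrow> \<zero>\<^bsub>NSym\<^esub> h = 0"
  by (simp add: NSym_def)

lemma NSym_one_M: "I \<in> vcomps \<Longrightarrow> \<one>\<^bsub>NSym\<^esub> (M I) = (if I = [] then 1 else 0)"
  by (auto simp: NSym_def Sdual_def M_in_QSym Mcoeff_M vcomps_def)

lemma Sdual_carrier:
  assumes "I \<in> vcomps"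
  shows "Sdual I \<in> carrier NSym"
proof (rule NSym_carrierI)
  show "qlinear (Sdual I)"
    using assms by (simp add: qlinear_def Sdual_def QSym_add QSym_scl Mcoeff_add Mcoeff_scl del: plus_fun_apply)
  show "Sdual I \<in> extensional QSym" by (simp add: Sdual_def)
  have "{sum_list J | J. J \<in> vcomps \<and> Sdual I (M J) \<noteq> 0} \<subseteq> {sum_list I}"
    using assms by (auto simp: Sdual_def M_in_QSym Mcoeff_M split: if_splits)
  then show "finite {sum_list J | J. J \<in> vcomps \<and> Sdual I (M J) \<noteq> 0}"
    by (rule finite_subset) simp
qed

lemma NSym_zero_closed: "\<zero>\<^bsub>NSym\<^esub> \<in> carrier NSym"
proof (rule NSym_carrierI)
  show "qlinear \<zero>\<^bsub>NSym\<^esub>"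
    by (simp add: qlinear_def NSym_zero_apply QSym_add QSym_scl del: plus_fun_apply)
  show "\<zero>\<^bsub>NSym\<^esub> \<in> extensional QSym" by (simp add: NSym_def)
  have "{sum_list J | J. J \<in> vcomps \<and> \<zero>\<^bsub>NSym\<^esub> (M J :: 'a pseries) \<noteq> 0} = {}"
    by (auto simp: NSym_zero_apply M_in_QSym)
  then show "finite {sum_list J | J. J \<in> vcomps \<and> \<zero>\<^bsub>NSym\<^esub> (M J :: 'a pseries) \<noteq> 0}" by (simp only: finite.emptyI)
qed

lemma NSym_add_closed:
  assumes "\<phi> \<in> carrier NSym" "\<psi> \<in> carrier NSym"
  shows "\<phi> \<oplus>\<^bsub>NSym\<^esub> \<psi> \<in> carrier NSym"
proof (rule NSym_carrierI)
  note lin = NSym_carrierD(1)[OF assms(1)] NSym_carrierD(1)[OF assms(2)]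
  show "qlinear (\<phi> \<oplus>\<^bsub>NSym\<^esub> \<psi>)"
    by (simp add: qlinear_def NSym_add_apply QSym_add QSym_scl lin[THEN qlinear_add]
        lin[THEN qlinear_scl] algebra_simps del: plus_fun_apply)
  show "\<phi> \<oplus>\<^bsub>NSym\<^esub> \<psi> \<in> extensional QSym" by (simp add: NSym_def)
  show "finite {sum_list J | J. J \<in> vcomps \<and> (\<phi> \<oplus>\<^bsub>NSym\<^esub> \<psi>) (M J) \<noteq> 0}"
    by (rule finite_subset[OF _ finite_UnI[OF NSym_carrierD(3)[OF assms(1)] NSym_carrierD(3)[OF assms(2)]]])
       (use NSym_add_apply[OF M_in_QSym] in fastforce)
qed

lemma NSym_mult_closed:
  assumes "\<phi> \<in> carrier NSym" "\<psi> \<in> carrier NSym"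
  shows "\<phi> \<otimes>\<^bsub>NSym\<^esub> \<psi> \<in> carrier NSym"
proof (rule NSym_carrierI)
  note lin = NSym_carrierD(1)[OF assms(1)] NSym_carrierD(1)[OF assms(2)]
  show "qlinear (\<phi> \<otimes>\<^bsub>NSym\<^esub> \<psi>)"
    by (simp add: qlinear_def NSym_def QSym_add QSym_scl coprod_add coprod_scl coprod_QSym
        tensor_functional_add[OF lin] tensor_functional_scl[OF lin] del: plus_fun_apply)
  show "\<phi> \<otimes>\<^bsub>NSym\<^esub> \<psi> \<in> extensional QSym" by (simp add: NSym_def)
  let ?A = "{sum_list J | J. J \<in> vcomps \<and> \<phi> (M J) \<noteq> 0}"
  let ?B = "{sum_list J | J. J \<in> vcomps \<and> \<psi> (M J) \<noteq> 0}"
  have "{sum_list J | J. J \<in> vcomps \<and> (\<phi> \<otimes>\<^bsub>NSym\<^esub> \<psi>) (M J) \<noteq> 0} \<subseteq> (\<lambda>(a, b). a + b) ` (?A \<times> ?B)"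
  proof
    fix n assume "n \<in> {sum_list J | J. J \<in> vcomps \<and> (\<phi> \<otimes>\<^bsub>NSym\<^esub> \<psi>) (M J) \<noteq> 0}"
    then obtain J where J: "n = sum_list J" "J \<in> vcomps" "(\<phi> \<otimes>\<^bsub>NSym\<^esub> \<psi>) (M J) \<noteq> 0" by blast
    then obtain r where "\<phi> (M (take r J)) * \<psi> (M (drop r J)) \<noteq> 0"
      unfolding NSym_mult_M[OF assms J(2)] by (meson sum.neutral)
    then have "sum_list (take r J) \<in> ?A" "sum_list (drop r J) \<in> ?B"
      using vcomps_take[OF J(2)] vcomps_drop[OF J(2)] by auto
    moreover have "n = sum_list (take r J) + sum_list (drop r J)"
      using J(1) by (metis append_take_drop_id sum_list_append)
    ultimately show "n \<in> (\<lambda>(a, b). a + b) ` (?A \<times> ?B)" by blast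
  qed
  then show "finite {sum_list J | J. J \<in> vcomps \<and> (\<phi> \<otimes>\<^bsub>NSym\<^esub> \<psi>) (M J) \<noteq> 0}"
    using NSym_carrierD(3)[OF assms(1)] NSym_carrierD(3)[OF assms(2)]
    by (meson finite_SigmaI finite_imageI finite_subset)
qed

lemma NSym_assoc:
  assumes "\<phi> \<in> carrier NSym" "\<psi> \<in> carrier NSym" "\<chi> \<in> carrier NSym"
  shows "(\<phi> \<otimes>\<^bsub>NSym\<^esub> \<psi>) \<otimes>\<^bsub>NSym\<^esub> \<chi> = \<phi> \<otimes>\<^bsub>NSym\<^esub> (\<psi> \<otimes>\<^bsub>NSym\<^esub> \<chi>)"
proof (rule NSym_eqI)
  fix I :: "'a mdeg list" assume I: "I \<in> vcomps"
  let ?F = "\<lambda>r s. \<phi> (M (take r I)) * \<psi> (M (take s (drop r I))) * \<chi> (M (drop (r + s) I))"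
  have "((\<phi> \<otimes>\<^bsub>NSym\<^esub> \<psi>) \<otimes>\<^bsub>NSym\<^esub> \<chi>) (M I) =
        (\<Sum>t\<le>length I. \<Sum>r\<le>t. ?F r (t - r))"
    by (simp add: NSym_mult_M assms NSym_mult_closed I vcomps_take sum_distrib_right)
       (intro sum.cong refl, auto simp: min_def drop_take)
  also have "\<dots> = (\<Sum>(t, r)\<in>Sigma {..length I} (\<lambda>t. {..t}). ?F r (t - r))"
    by (rule sum.Sigma) auto
  also have "\<dots> = (\<Sum>(r, s)\<in>Sigma {..length I} (\<lambda>r. {..length I - r}). ?F r s)"
    by (rule sum.reindex_bij_witness[of _ "\<lambda>(r, s). (r + s, r)" "\<lambda>(t, r). (r, t - r)"]) auto
  also have "\<dots> = (\<Sum>r\<le>length I. \<Sum>s\<le>length I - r. ?F r s)"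
    by (rule sum.Sigma[symmetric]) auto
  also have "\<dots> = (\<phi> \<otimes>\<^bsub>NSym\<^esub> (\<psi> \<otimes>\<^bsub>NSym\<^esub> \<chi>)) (M I)"
    by (simp add: NSym_mult_M assms NSym_mult_closed I vcomps_drop sum_distrib_left mult.assoc add.commute)
  finally show "((\<phi> \<otimes>\<^bsub>NSym\<^esub> \<psi>) \<otimes>\<^bsub>NSym\<^esub> \<chi>) (M I) = (\<phi> \<otimes>\<^bsub>NSym\<^esub> (\<psi> \<otimes>\<^bsub>NSym\<^esub> \<chi>)) (M I)" .
qed (intro NSym_mult_closed assms)+

lemma NSym_ring: "ring (NSym :: (('l::finite) pseries \<Rightarrow> rat) ring)"
proof (rule ringI)
  have one: "\<one>\<^bsub>NSym\<^esub> \<in> carrier (NSym :: ('l pseries \<Rightarrow> rat) ring)"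
    using Sdual_carrier[of "[]"] by (simp add: NSym_def vcomps_def)
  show "abelian_group (NSym :: ('l pseries \<Rightarrow> rat) ring)"
  proof (rule abelian_groupI)
    fix \<phi> :: "'l pseries \<Rightarrow> rat" assume \<phi>: "\<phi> \<in> carrier NSym"
    let ?n = "\<lambda>h\<in>QSym. - \<phi> h"
    note lin = NSym_carrierD(1)[OF \<phi>]
    have n: "?n \<in> carrier NSym"
    proof (rule NSym_carrierI)
      show "qlinear ?n"
        by (simp add: qlinear_def QSym_add QSym_scl qlinear_add[OF lin] qlinear_scl[OF lin] del: plus_fun_apply)
      show "finite {sum_list I | I. I \<in> vcomps \<and> ?n (M I) \<noteq> 0}"
        by (rule finite_subset[OF _ NSym_carrierD(3)[OF \<phi>]]) (auto simp: M_in_QSym)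
    qed simp
    have "?n \<oplus>\<^bsub>NSym\<^esub> \<phi> = \<zero>\<^bsub>NSym\<^esub>"
      by (rule NSym_eqI)
         (use n \<phi> in \<open>auto simp: NSym_add_closed NSym_zero_closed NSym_add_apply NSym_zero_apply M_in_QSym\<close>)
    with n show "\<exists>\<psi>\<in>carrier NSym. \<psi> \<oplus>\<^bsub>NSym\<^esub> \<phi> = \<zero>\<^bsub>NSym\<^esub>" by blast
  qed (auto intro!: NSym_eqI simp: NSym_add_closed NSym_zero_closed NSym_add_apply NSym_zero_apply M_in_QSym)
  show "monoid (NSym :: ('l pseries \<Rightarrow> rat) ring)"
  proof (rule monoidI)
    fix \<phi> :: "'l pseries \<Rightarrow> rat" assume \<phi>: "\<phi> \<in> carrier NSym"
    show "\<one>\<^bsub>NSym\<^esub> \<otimes>\<^bsub>NSym\<^esub> \<phi> = \<phi>"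
    proof (rule NSym_eqI)
      fix I :: "'l mdeg list" assume I: "I \<in> vcomps"
      have "(\<one>\<^bsub>NSym\<^esub> \<otimes>\<^bsub>NSym\<^esub> \<phi>) (M I) = (\<Sum>r\<le>length I. if r = 0 then \<phi> (M I) else 0)"
        unfolding NSym_mult_M[OF one \<phi> I]
        by (intro sum.cong refl) (auto simp: NSym_one_M vcomps_take I)
      then show "(\<one>\<^bsub>NSym\<^esub> \<otimes>\<^bsub>NSym\<^esub> \<phi>) (M I) = \<phi> (M I)" by simp
    qed (intro NSym_mult_closed one \<phi>)+
    show "\<phi> \<otimes>\<^bsub>NSym\<^esub> \<one>\<^bsub>NSym\<^esub> = \<phi>"
    proof (rule NSym_eqI)
      fix I :: "'l mdeg list" assume I: "I \<in> vcomps"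
      have "(\<phi> \<otimes>\<^bsub>NSym\<^esub> \<one>\<^bsub>NSym\<^esub>) (M I) = (\<Sum>r\<le>length I. if r = length I then \<phi> (M I) else 0)"
        unfolding NSym_mult_M[OF \<phi> one I]
        by (intro sum.cong refl) (auto simp: NSym_one_M vcomps_drop I)
      then show "(\<phi> \<otimes>\<^bsub>NSym\<^esub> \<one>\<^bsub>NSym\<^esub>) (M I) = \<phi> (M I)" by simp
    qed (intro NSym_mult_closed one \<phi>)+
  qed (simp_all add: NSym_mult_closed one NSym_assoc)
  fix \<phi> \<psi> \<chi> :: "'l pseries \<Rightarrow> rat"
  assume c: "\<phi> \<in> carrier NSym" "\<psi> \<in> carrier NSym" "\<chi> \<in> carrier NSym"
  show "(\<phi> \<oplus>\<^bsub>NSym\<^esub> \<psi>) \<otimes>\<^bsub>NSym\<^esub> \<chi> = \<phi> \<otimes>\<^bsub>NSym\<^esub> \<chi> \<oplus>\<^bsub>NSym\<^esub> \<psi> \<otimes>\<^bsub>NSym\<^esub> \<chi>"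
    by (rule NSym_eqI) (simp_all add: c NSym_mult_closed NSym_add_closed NSym_add_apply NSym_mult_M
        M_in_QSym vcomps_take vcomps_drop distrib_right sum.distrib)
  show "\<chi> \<otimes>\<^bsub>NSym\<^esub> (\<phi> \<oplus>\<^bsub>NSym\<^esub> \<psi>) = \<chi> \<otimes>\<^bsub>NSym\<^esub> \<phi> \<oplus>\<^bsub>NSym\<^esub> \<chi> \<otimes>\<^bsub>NSym\<^esub> \<psi>"
    by (rule NSym_eqI) (simp_all add: c NSym_mult_closed NSym_add_closed NSym_add_apply NSym_mult_M
        M_in_QSym vcomps_take vcomps_drop distrib_left sum.distrib)
qed

lemma Sdual_append:
  assumes "I \<in> vcomps" "J \<in> vcomps"
  shows "Sdual (I @ J) = Sdual I \<otimes>\<^bsub>NSym\<^esub> Sdual J"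
proof (rule NSym_eqI)
  have IJ: "I @ J \<in> vcomps" using assms by (auto simp: vcomps_def)
  then show "Sdual (I @ J) \<in> carrier NSym" by (rule Sdual_carrier)
  show "Sdual I \<otimes>\<^bsub>NSym\<^esub> Sdual J \<in> carrier NSym"
    using assms by (intro NSym_mult_closed Sdual_carrier)
  fix K :: "'a mdeg list" assume K: "K \<in> vcomps"
  have S: "Sdual L (M L') = (if L = L' then 1 else 0)" if "L \<in> vcomps" "L' \<in> vcomps" for L L' :: "'a mdeg list"
    using that by (simp add: Sdual_def M_in_QSym Mcoeff_M)
  have "(Sdual I \<otimes>\<^bsub>NSym\<^esub> Sdual J) (M K) =
        (\<Sum>r\<le>length K. if r = length I then (if K = I @ J then 1 else 0) else 0)"
    unfolding NSym_mult_M[OF Sdual_carrier[OF assms(1)] Sdual_carrier[OF assms(2)] K]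
  proof (intro sum.cong refl)
    fix r assume "r \<in> {..length K}"
    then have "length (take r K) = r" by simp
    then have "I = take r K \<and> J = drop r K \<longleftrightarrow> r = length I \<and> K = I @ J"
      by (metis append_eq_conv_conj)
    then show "Sdual I (M (take r K)) * Sdual J (M (drop r K)) =
        (if r = length I then (if K = I @ J then 1 else 0) else 0)"
      unfolding S[OF assms(1) vcomps_take[OF K]] S[OF assms(2) vcomps_drop[OF K]]
      by (smt (verit) mult_zero_left mult_zero_right mult_1_left)
  qed
  also have "\<dots> = Sdual (I @ J) (M K)" using S[OF IJ K] by auto
  finally show "Sdual (I @ J) (M K) = (Sdual I \<otimes>\<^bsub>NSym\<^esub> Sdual J) (M K)" by simp
qed

lemma tensor_space_mono: "V \<subseteq> V' \<Longrightarrow> W \<subseteq> W' \<Longrightarrow> tensor_space V W \<subseteq> tensor_space V' W'"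
  unfolding tensor_space_def by (rule fvs.span_mono) blast

lemma even_subcoalgebra_sum:
  fixes k :: "'l::finite \<Rightarrow> enat"
  shows "even_subcoalgebra k (fvs.span (\<Union>{C. even_subcoalgebra k C}))"
proof -
  let ?U = "\<Union>{C. even_subcoalgebra k C}"
  let ?E = "fvs.span ?U"
  have U: "x \<in> QSym \<and> hcomp n x \<in> ?E \<and> coprod x \<in> tensor_space ?E ?E \<and>
      (mdeg_le n k \<longrightarrow> ((-1) ^ tdeg n - 1) * zeta (hcomp n x) = 0)" if x: "x \<in> ?U" for x n
  proof -
    obtain C where C: "even_subcoalgebra k C" "x \<in> C" using x by blast
    have sub: "C \<subseteq> ?E" using C(1) fvs.span_superset[of ?U] by blast
    have g: "C \<subseteq> QSym" "hcomp n x \<in> C" "coprod x \<in> tensor_space C C"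
      using C unfolding even_subcoalgebra_def graded_subcoalgebra_def by blast+
    have "bar zeta (hcomp n x) = zeta (hcomp n x)" if "mdeg_le n k"
      using C(1) g(2) that homogeneous_hcomp[of n x] unfolding even_subcoalgebra_def by blast
    moreover have "bar zeta (hcomp n x) = (-1) ^ tdeg n * zeta (hcomp n x)"
      using g by (intro bar_homogeneous qlinear_zeta homogeneous_hcomp) blast
    ultimately show ?thesis
      using g sub tensor_space_mono[OF sub sub] C(2) by (auto simp: left_diff_distrib)
  qed
  have E: "h \<in> QSym \<and> (\<forall>n. hcomp n h \<in> ?E) \<and> coprod h \<in> tensor_space ?E ?E \<and>
      (\<forall>n. mdeg_le n k \<longrightarrow> ((-1) ^ tdeg n - 1) * zeta (hcomp n h) = 0)" if "h \<in> ?E" for h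
    using that
  proof (induction rule: fvs.span_induct_alt)
    case base
    have "(0 :: 'l pseries) \<in> QSym \<and> (\<forall>n. hcomp n (0 :: 'l pseries) \<in> ?E) \<and>
      coprod (0 :: 'l pseries) \<in> tensor_space ?E ?E \<and>
      (\<forall>n. mdeg_le n k \<longrightarrow> ((-1) ^ tdeg n - 1) * zeta (hcomp n (0 :: 'l pseries)) = 0)"
      unfolding hcomp_0 coprod_0
      by (simp add: QSym_0 fvs.span_zero fvs.subspace_0[OF subspace_tensor_space]
          qlinear_0[OF qlinear_zeta] del: zero_fun_apply)
    then show ?case unfolding zero_fun_def by blast
  next
    case (step c x y)
    note Ux = U[OF step(1)]
    have x: "x \<in> QSym" "scl c x \<in> QSym" and y: "y \<in> QSym" using Ux step(2) QSym_scl by blast+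
    have "coprod (scl c x + y) \<in> tensor_space ?E ?E"
      unfolding coprod_add[OF x(2) y] coprod_scl[OF x(1)]
      using Ux step(2) subspace_tensor_space fvs.subspace_add fvs.subspace_scale by blast
    moreover have "hcomp n (scl c x + y) \<in> ?E" for n
      unfolding hcomp_add hcomp_scl using Ux step(2) fvs.span_add fvs.span_scale by blast
    moreover have "((-1) ^ tdeg n - 1) * zeta (hcomp n (scl c x + y)) = 0" if "mdeg_le n k" for n
    proof -
      have "zeta (hcomp n (scl c x + y)) = c * zeta (hcomp n x) + zeta (hcomp n y)"
        unfolding hcomp_add hcomp_scl using x y
        by (simp add: qlinear_add[OF qlinear_zeta] qlinear_scl[OF qlinear_zeta] hcomp_QSym QSym_scl
            del: plus_fun_apply)
      then show ?thesis using Ux[of n] step(2) that by (auto simp: distrib_left)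
    qed
    ultimately show ?case using QSym_add[OF x(2) y] by blast
  qed
  have "bar zeta h = zeta h" if "mdeg_le n k" "h \<in> ?E" "homogeneous n h" for n h
  proof -
    have "hcomp n h = h" using hcomp_homogeneous[OF that(3), of n] by simp
    then show ?thesis
      using E[OF that(2)] that(1) bar_homogeneous[OF qlinear_zeta _ that(3)]
      by (auto simp: left_diff_distrib)
  qed
  then show ?thesis
    using E fvs.subspace_span[of ?U] unfolding even_subcoalgebra_def graded_subcoalgebra_def by blast
qed

lemma even_subalgebra_greatest:
  shows "even_subcoalgebra k (even_subalgebra k)"
    and "even_subcoalgebra k C \<Longrightarrow> C \<subseteq> even_subalgebra k"
proof -
  let ?E = "fvs.span (\<Union>{C. even_subcoalgebra k C})"
  have sub: "C \<subseteq> ?E" if "even_subcoalgebra k C" for C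
    using that fvs.span_superset[of "\<Union>{C. even_subcoalgebra k C}"] by blast
  have eq: "even_subalgebra k = ?E"
    unfolding even_subalgebra_def
    by (rule Greatest_equality[where P = "even_subcoalgebra k"]) (rule even_subcoalgebra_sum, rule sub)
  show "even_subcoalgebra k (even_subalgebra k)" unfolding eq by (rule even_subcoalgebra_sum)
  show "C \<subseteq> even_subalgebra k" if "even_subcoalgebra k C" unfolding eq using sub[OF that] .
qed

end

theory Submission
  imports Defs
begin

text \<open>
  The degree \<open>n\<close> part of \<open>bar zeta - zeta\<close> is \<open>(-1) ^ tdeg n - 1\<close> times that of \<open>zeta\<close>, so it
  is zero or \<open>-2\<close> times \<open>Sdual [n]\<close>, and \<open>-2\<close> is invertible over the rationals. For the
  coalgebra, the functionals vanishing on a subcoalgebra \<open>C\<close> form a two-sided ideal of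
  \<open>NSym\<close>; if \<open>C\<close> is even, this ideal contains \<open>Sdual [n]\<close> for every forbidden part \<open>n\<close>, hence
  \<open>Sdual (A @ n # B)\<close>, which reads off the coefficient at \<open>M (A @ n # B)\<close>.
\<close>

section \<open>Rational scalars in the ring \<open>NSym\<close>\<close>

text \<open>\<open>NSym\<close> carries only a ring structure, so scalars come separately.
  Restriction to \<open>QSym\<close> keeps the result extensional, as the carrier demands.\<close>

definition nscl :: "rat \<Rightarrow> (('l::finite) pseries \<Rightarrow> rat) \<Rightarrow> 'l pseries \<Rightarrow> rat" where
  "nscl c \<phi> = (\<lambda>h\<in>QSym. c * \<phi> h)"

lemma nscl_closed:
  assumes "\<phi> \<in> carrier NSym"
  shows "nscl c \<phi> \<in> carrier NSym"
proof (rule NSym_carrierI)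
  note lin = NSym_carrierD(1)[OF assms]
  show "qlinear (nscl c \<phi>)"
    by (simp add: qlinear_def nscl_def QSym_add QSym_scl qlinear_add[OF lin] qlinear_scl[OF lin]
        distrib_left del: plus_fun_apply)
  show "nscl c \<phi> \<in> extensional QSym" by (simp add: nscl_def)
  show "finite {sum_list I | I. I \<in> vcomps \<and> nscl c \<phi> (M I) \<noteq> 0}"
    by (rule finite_subset[OF _ NSym_carrierD(3)[OF assms]]) (auto simp: nscl_def M_in_QSym)
qed

text \<open>The unit vanishes on every \<open>M I\<close> with \<open>I\<close> nonempty, so only
  the cut \<open>r = 0\<close> survives. Its purpose is to make ring ideals closed under rational
  scalars.\<close>

lemma nscl_eq_mult:
  assumes "\<phi> \<in> carrier NSym"
  shows "nscl c \<phi> = nscl c \<one>\<^bsub>NSym\<^esub> \<otimes>\<^bsub>NSym\<^esub> \<phi>"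
proof -
  interpret ring "NSym :: ('a pseries \<Rightarrow> rat) ring" by (rule NSym_ring)
  show ?thesis
  proof (rule NSym_eqI)
    fix I :: "'a mdeg list" assume I: "I \<in> vcomps"
    have "(nscl c \<one>\<^bsub>NSym\<^esub> \<otimes>\<^bsub>NSym\<^esub> \<phi>) (M I) = (\<Sum>r\<le>length I. if r = 0 then c * \<phi> (M I) else 0)"
      unfolding NSym_mult_M[OF nscl_closed[OF one_closed] assms I]
      by (intro sum.cong refl) (auto simp: nscl_def NSym_one_M vcomps_take M_in_QSym I)
    then show "nscl c \<phi> (M I) = (nscl c \<one>\<^bsub>NSym\<^esub> \<otimes>\<^bsub>NSym\<^esub> \<phi>) (M I)"
      by (simp add: nscl_def M_in_QSym I)
  qed (intro nscl_closed m_closed one_closed assms)+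
qed

lemma nscl_in_ideal:
  assumes "ideal J NSym" "\<phi> \<in> J"
  shows "nscl c \<phi> \<in> J"
proof -
  interpret ideal J NSym by (rule assms(1))
  have "\<phi> \<in> carrier NSym" using a_subset assms(2) by blast
  then show ?thesis
    unfolding nscl_eq_mult[OF \<open>\<phi> \<in> carrier NSym\<close>]
    by (intro I_l_closed assms(2) nscl_closed one_closed)
qed

lemma NSym_diff_nscl:
  fixes \<phi> :: "('l::finite) pseries \<Rightarrow> rat"
  assumes "\<phi> \<in> carrier NSym"
  shows "nscl c \<phi> \<ominus>\<^bsub>NSym\<^esub> \<phi> = nscl (c - 1) \<phi>"
proof -
  interpret ring "NSym :: ('l pseries \<Rightarrow> rat) ring" by (rule NSym_ring)
  \<comment> \<open>The additive inverse of the ring comes without a formula for its values, so the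
    difference is checked by adding \<open>\<phi>\<close> back.\<close>
  have "nscl (c - 1) \<phi> \<oplus>\<^bsub>NSym\<^esub> \<phi> = nscl c \<phi>"
  proof (rule NSym_eqI)
    fix I :: "'l mdeg list" assume "I \<in> vcomps"
    then show "(nscl (c - 1) \<phi> \<oplus>\<^bsub>NSym\<^esub> \<phi>) (M I) = nscl c \<phi> (M I)"
      by (simp add: NSym_add_apply M_in_QSym nscl_def left_diff_distrib)
  qed (intro a_closed nscl_closed assms)+
  then show ?thesis
    using a_assoc[OF nscl_closed[OF assms] assms a_inv_closed[OF assms]]
      r_neg[OF assms] r_zero[OF nscl_closed[OF assms]] by (simp only: a_minus_def) metis
qed

section \<open>Homogeneous parts of \<open>zeta\<close> and the even ideal\<close>

text \<open>The homogeneous parts of \<open>zeta\<close> include \<open>S\<^sub>0 = 1\<close>, which is \<open>Sdual []\<close> and not \<open>Sdual [0]\<close>.\<close>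

definition one_part :: "'l mdeg \<Rightarrow> 'l mdeg list" where
  "one_part n = (if n = 0 then [] else [n])"

lemma one_part_vcomps: "one_part n \<in> vcomps"
  by (simp add: one_part_def vcomps_def)

lemma zeta_hcomp: "h \<in> QSym \<Longrightarrow> zeta (hcomp n h) = Mcoeff (one_part n) h"
proof (induction rule: QSym_induct)
  case zero
  have "Mcoeff (one_part n) 0 = 0"
    unfolding Mcoeff_eq[OF QSym_0 one_part_vcomps] by simp
  then show ?case unfolding hcomp_0 qlinear_0[OF qlinear_zeta] by (rule sym)
next
  case (step c I h)
  \<comment> \<open>Entries of a vector composition are nonzero, so \<open>[0]\<close> is excluded
    and each degree has exactly one composition of length at most one.\<close>
  have "n = sum_list I \<and> length I \<le> 1 \<longleftrightarrow> one_part n = I"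
    using step(1) by (cases I; cases "tl I") (auto simp: one_part_def vcomps_def)
  then have "zeta (hcomp n (M I)) = Mcoeff (one_part n) (M I)"
    unfolding hcomp_homogeneous[OF homogeneous_M] Mcoeff_M[OF one_part_vcomps step(1)]
    using zeta_M[OF step(1)] qlinear_0[OF qlinear_zeta] by (simp only: split: if_splits) auto
  then show ?case
    using step by (simp only: hcomp_add hcomp_scl qlinear_add[OF qlinear_zeta]
        qlinear_scl[OF qlinear_zeta] Mcoeff_add Mcoeff_scl QSym_scl M_in_QSym hcomp_QSym one_part_vcomps)
qed

lemma deg_part_zeta: "deg_part n zeta = Sdual (one_part n)"
  unfolding deg_part_def Sdual_def by (rule restrict_ext) (rule zeta_hcomp)

lemma deg_part_bar_zeta: "deg_part n (bar zeta) = nscl ((-1) ^ tdeg n) (Sdual (one_part n))"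
  unfolding deg_part_def nscl_def
proof (rule restrict_ext)
  fix h :: "'a pseries" assume h: "h \<in> QSym"
  show "bar zeta (hcomp n h) = (-1) ^ tdeg n * Sdual (one_part n) h"
    using h unfolding bar_homogeneous[OF qlinear_zeta hcomp_QSym[OF h] homogeneous_hcomp]
    by (simp add: zeta_hcomp Sdual_def)
qed

lemma even_ideal_generator:
  "deg_part n (bar zeta) \<ominus>\<^bsub>NSym\<^esub> deg_part n zeta =
     nscl ((-1) ^ tdeg n - 1) (Sdual (one_part n))"
  unfolding deg_part_zeta deg_part_bar_zeta by (intro NSym_diff_nscl Sdual_carrier one_part_vcomps)

lemma mdeg_pos_iff: "0 < n \<longleftrightarrow> n \<noteq> (0 :: 'l mdeg)"
  by (auto simp: less_le le_fun_def)

lemma odd_tdeg_pos: "odd (tdeg n) \<Longrightarrow> n \<noteq> 0"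
  by (auto simp: tdeg_def)

text \<open>Each generating set lies in the ideal generated by the other; minimality of generated
  ideals does the rest.\<close>

lemma even_ideal_eq:
  fixes k :: "'l::finite \<Rightarrow> enat"
  shows "even_ideal k = genideal NSym {Sdual [n] | n. 0 < n \<and> mdeg_le n k \<and> odd (tdeg n)}"
proof -
  interpret ring "NSym :: ('l pseries \<Rightarrow> rat) ring" by (rule NSym_ring)
  let ?g = "\<lambda>n. nscl ((-1) ^ tdeg n - 1) (Sdual (one_part n))"
  let ?X = "{?g n | n :: 'l mdeg. mdeg_le n k}"
  let ?Y = "{Sdual [n] | n :: 'l mdeg. 0 < n \<and> mdeg_le n k \<and> odd (tdeg n)}"
  have X: "?X \<subseteq> carrier NSym"
    by (auto intro: nscl_closed Sdual_carrier one_part_vcomps)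
  have Y: "?Y \<subseteq> carrier NSym"
    by (auto simp: mdeg_pos_iff vcomps_def intro!: Sdual_carrier)
  have XY: "?X \<subseteq> Idl\<^bsub>NSym\<^esub> ?Y"
  proof safe
    fix n assume n: "mdeg_le n k"
    show "?g n \<in> Idl\<^bsub>NSym\<^esub> ?Y"
    proof (cases "even (tdeg n)")
      case True
      \<comment> \<open>This case covers \<open>n = 0\<close>, so the unit, which is the degree 0
        part of \<open>zeta\<close>, contributes nothing.\<close>
      then have "?g n = \<zero>\<^bsub>NSym\<^esub>" by (simp add: nscl_def NSym_def)
      then show ?thesis using additive_subgroup.zero_closed[OF ideal.axioms(1)[OF genideal_ideal[OF Y]]]
        by simp
    next
      case False
      then have "Sdual (one_part n) \<in> ?Y"
        using n odd_tdeg_pos[of n] by (auto simp: one_part_def mdeg_pos_iff)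
      then have "Sdual (one_part n) \<in> Idl\<^bsub>NSym\<^esub> ?Y" using genideal_self[OF Y] by blast
      then show ?thesis by (rule nscl_in_ideal[OF genideal_ideal[OF Y]])
    qed
  qed
  have YX: "?Y \<subseteq> Idl\<^bsub>NSym\<^esub> ?X"
  proof safe
    fix n :: "'l mdeg" assume n: "0 < n" "mdeg_le n k" "odd (tdeg n)"
    have "?g n \<in> Idl\<^bsub>NSym\<^esub> ?X" using genideal_self[OF X] n(2) by blast
    \<comment> \<open>For odd degree the scalar in \<open>?g n\<close> is -2, which this factor
      cancels.\<close>
    then have "nscl (- 1 / 2) (?g n) \<in> Idl\<^bsub>NSym\<^esub> ?X" by (rule nscl_in_ideal[OF genideal_ideal[OF X]])
    moreover have "nscl (- 1 / 2) (?g n) = Sdual [n]"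
      using n by (auto simp: nscl_def Sdual_def one_part_def mdeg_pos_iff intro!: restrict_ext)
    ultimately show "Sdual [n] \<in> Idl\<^bsub>NSym\<^esub> ?X" by simp
  qed
  have "Idl\<^bsub>NSym\<^esub> ?X = Idl\<^bsub>NSym\<^esub> ?Y"
    by (rule equalityI; rule genideal_minimal[OF genideal_ideal]; rule X Y XY YX)
  then show ?thesis unfolding even_ideal_def even_ideal_generator .
qed

section \<open>The span of the even compositions is an even subcoalgebra\<close>

definition even_comps :: "(('l::finite) \<Rightarrow> enat) \<Rightarrow> 'l mdeg list set" where
  "even_comps k = {I \<in> vcomps. \<forall>n\<in>set I. mdeg_le n k \<longrightarrow> even (tdeg n)}"

text \<open>Evaluation at \<open>lmon I\<close> reads off the coefficient at \<open>M I\<close>, and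
  it kills \<open>M J\<close> for every other composition \<open>J\<close>.\<close>

lemma Mcoeff_span_eq_0:
  assumes "h \<in> fvs.span (M ` A)" "A \<subseteq> vcomps" "I \<in> vcomps" "I \<notin> A"
  shows "Mcoeff I h = 0"
proof -
  have "h \<in> QSym" using assms(1,2) unfolding QSym_def by (meson fvs.span_mono image_mono subsetD)
  moreover have "h (lmon I) = 0" using assms(1)
  proof (induction rule: fvs.span_induct_alt)
    case (step c x y)
    then obtain J where "J \<in> A" "x = M J" by blast
    moreover have "M J (lmon I) = 0"
      using M_lmon[of J I] \<open>J \<in> A\<close> assms(2-4) by auto
    ultimately show ?case using step(2) by (simp add: scl_def)
  qed simp
  ultimately show ?thesis by (simp add: Mcoeff_eq assms(3))
qed

text \<open>The parity condition concerns each entry separately, so prefixes and suffixes inherit it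
  and deconcatenation stays in the span.\<close>

lemma even_subcoalgebra_span:
  fixes k :: "'l::finite \<Rightarrow> enat"
  shows "even_subcoalgebra k (fvs.span (M ` even_comps k))"
proof -
  let ?E = "fvs.span (M ` even_comps k)"
  have sub: "even_comps k \<subseteq> vcomps" by (auto simp: even_comps_def)
  then have EQ: "?E \<subseteq> QSym" unfolding QSym_def by (intro fvs.span_mono image_mono)
  have td: "take r I \<in> even_comps k" "drop r I \<in> even_comps k" if "I \<in> even_comps k" for I r
    using that by (auto simp: even_comps_def vcomps_take vcomps_drop dest: in_set_takeD in_set_dropD)
  have tens: "coprod (M I) \<in> tensor_space ?E ?E" if "I \<in> even_comps k" for I
  proof -
    have "tensor (M (take r I)) (M (drop r I)) \<in> tensor_space ?E ?E" for r
      unfolding tensor_space_def using td[OF that] by (blast intro: fvs.span_base)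
    then show ?thesis
      using that sub by (subst coprod_M) (blast intro: fvs.subspace_sum[OF subspace_tensor_space])+
  qed
  have E: "h \<in> QSym \<and> (\<forall>n. hcomp n h \<in> ?E) \<and> coprod h \<in> tensor_space ?E ?E" if "h \<in> ?E" for h
    using that
  proof (induction rule: fvs.span_induct_alt)
    case base
    show ?case
      unfolding zero_fun_def[symmetric] hcomp_0 coprod_0
      using QSym_0 fvs.span_zero fvs.subspace_0[OF subspace_tensor_space] by blast
  next
    case (step c x y)
    obtain I where I: "I \<in> even_comps k" "x = M I" using step(1) by blast
    have x: "x \<in> ?E" "x \<in> QSym" using I sub fvs.span_base M_in_QSym by blast+
    have "hcomp n x \<in> ?E" for n
      using x(1) fvs.span_zero[of "M ` even_comps k"]
      unfolding I(2) hcomp_homogeneous[OF homogeneous_M] by (simp del: zero_fun_apply)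
    then have "hcomp n (scl c x + y) \<in> ?E" for n
      unfolding hcomp_add hcomp_scl using step(2) by (intro fvs.span_add fvs.span_scale) blast+
    moreover have "coprod (scl c x + y) \<in> tensor_space ?E ?E"
      using tens[OF I(1)] step(2) x(2) unfolding I(2)
      by (simp only: coprod_add coprod_scl QSym_scl fvs.subspace_add[OF subspace_tensor_space]
          fvs.subspace_scale[OF subspace_tensor_space])
    ultimately show ?case using QSym_add[OF QSym_scl[OF x(2)]] step(2) by blast
  qed
  have "bar zeta h = zeta h" if n: "mdeg_le n k" and h: "h \<in> ?E" "homogeneous n h" for n h
  proof (cases "even (tdeg n)")
    case True
    then show ?thesis using bar_homogeneous[OF qlinear_zeta _ h(2)] h(1) EQ by auto
  next
    case False
    \<comment> \<open>Here both sides vanish: in degree \<open>n\<close>, \<open>zeta\<close> only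
      sees the coefficient at the excluded composition \<open>[n]\<close>.\<close>
    have "one_part n \<notin> even_comps k"
      using False n odd_tdeg_pos[OF False] by (auto simp: one_part_def even_comps_def)
    then have "Mcoeff (one_part n) h = 0"
      using Mcoeff_span_eq_0[OF h(1) sub one_part_vcomps] by blast
    then have "zeta h = 0"
      using zeta_hcomp[of h n] hcomp_homogeneous[OF h(2), of n] h(1) EQ by auto
    then show ?thesis using bar_homogeneous[OF qlinear_zeta _ h(2)] h(1) EQ by auto
  qed
  then show ?thesis
    using E EQ fvs.subspace_span unfolding even_subcoalgebra_def graded_subcoalgebra_def by blast
qed

section \<open>Annihilators of subcoalgebras and maximality\<close>

lemma tensor_functional_tensor_space:
  fixes C :: "('l::finite) pseries set"
  assumes "qlinear \<phi>" "qlinear \<psi>" "C \<subseteq> QSym"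
    and "(\<forall>f\<in>C. \<phi> f = 0) \<or> (\<forall>g\<in>C. \<psi> g = 0)" and "T \<in> tensor_space C C"
  shows "tensor_functional \<phi> \<psi> T = 0"
proof -
  let ?Q = "tensor_space (QSym :: 'l pseries set) (QSym :: 'l pseries set)"
  \<comment> \<open>Membership in \<open>?Q\<close> is carried through the induction because
    additivity of \<open>tensor_functional\<close> holds there.\<close>
  have "T \<in> ?Q \<and> tensor_functional \<phi> \<psi> T = 0"
    using assms(5) unfolding tensor_space_def[of C C]
  proof (induction rule: fvs.span_induct_alt)
    case base
    have "tensor_functional \<phi> \<psi> 0 = 0"
      by (simp add: tensor_functional_def zero_fun_def
          qlinear_0[OF assms(1), unfolded zero_fun_def] qlinear_0[OF assms(2), unfolded zero_fun_def])
    then show ?case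
      unfolding zero_fun_def[symmetric] using fvs.subspace_0[OF subspace_tensor_space] by blast
  next
    case (step c x y)
    then obtain f g where fg: "x = tensor f g" "f \<in> C" "g \<in> C" by blast
    then have Q: "f \<in> QSym" "g \<in> QSym" using assms(3) by auto
    have x: "x \<in> ?Q" unfolding fg(1) tensor_space_def using Q by (blast intro: fvs.span_base)
    have "tensor_functional \<phi> \<psi> x = 0"
      using tensor_functional_tensor[OF assms(1,2) Q] assms(4) fg by auto
    then show ?case
      using step(2) x tensor_functional_add[OF assms(1,2)] tensor_functional_scl[OF assms(1,2) x]
        fvs.subspace_add[OF subspace_tensor_space] fvs.subspace_scale[OF subspace_tensor_space]
      by (metis add_0 mult_zero_right)
  qed
  then show ?thesis ..
qed

text \<open>The product factors through \<open>coprod h\<close>, which lies in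
  \<open>tensor_space C C\<close>, where one tensor factor is killed. This is the absorption law for
  the annihilator of \<open>C\<close>, on both sides.\<close>

lemma NSym_mult_annihilates:
  assumes "graded_subcoalgebra C" "\<phi> \<in> carrier NSym" "\<psi> \<in> carrier NSym"
    and "(\<forall>f\<in>C. \<phi> f = 0) \<or> (\<forall>g\<in>C. \<psi> g = 0)" and "h \<in> C"
  shows "(\<phi> \<otimes>\<^bsub>NSym\<^esub> \<psi>) h = 0"
proof -
  have C: "C \<subseteq> QSym" "coprod h \<in> tensor_space C C"
    using assms(1,5) by (auto simp: graded_subcoalgebra_def)
  then have "tensor_functional \<phi> \<psi> (coprod h) = 0"
    using assms by (intro tensor_functional_tensor_space[of _ _ C] NSym_carrierD)
  then show ?thesis using C assms(5) by (auto simp: NSym_def)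
qed

lemma even_subcoalgebra_subset_span:
  fixes k :: "'l::finite \<Rightarrow> enat"
  assumes "even_subcoalgebra k C"
  shows "C \<subseteq> fvs.span (M ` even_comps k)"
proof
  fix h assume h: "h \<in> C"
  have C: "graded_subcoalgebra C" "C \<subseteq> QSym"
    using assms by (auto simp: even_subcoalgebra_def graded_subcoalgebra_def)
  \<comment> \<open>In odd degree, evenness reads \<open>- zeta = zeta\<close>, so
    \<open>zeta\<close> vanishes on the degree \<open>n\<close> part; its value there is the
    coefficient at \<open>[n]\<close>.\<close>
  have S: "Sdual [n] g = 0" if n: "mdeg_le n k" "odd (tdeg n)" and g: "g \<in> C" for n g
  proof -
    have "hcomp n g \<in> C" using C(1) g by (auto simp: graded_subcoalgebra_def)
    then have "bar zeta (hcomp n g) = zeta (hcomp n g)" "hcomp n g \<in> QSym"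
      using assms n(1) homogeneous_hcomp C(2) unfolding even_subcoalgebra_def by blast+
    then have "zeta (hcomp n g) = 0"
      using bar_homogeneous[OF qlinear_zeta _ homogeneous_hcomp, of n g] n(2) by simp
    then show ?thesis
      using zeta_hcomp[of g n] g C(2) odd_tdeg_pos[OF n(2)] by (auto simp: Sdual_def one_part_def)
  qed
  have coeff: "I \<in> even_comps k" if I: "I \<in> vcomps" "Mcoeff I h \<noteq> 0" for I
  proof (rule ccontr)
    assume "I \<notin> even_comps k"
    then obtain n where n: "n \<in> set I" "mdeg_le n k" "odd (tdeg n)"
      using I(1) by (auto simp: even_comps_def)
    then obtain A B where AB: "I = A @ [n] @ B" by (auto simp: in_set_conv_decomp)
    have v: "A \<in> vcomps" "[n] \<in> vcomps" "B \<in> vcomps" "[n] @ B \<in> vcomps"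
      using I(1) by (auto simp: AB vcomps_def)
    \<comment> \<open>Annihilation spreads from \<open>Sdual [n]\<close> by right multiplication
      with \<open>Sdual B\<close>, then by left multiplication with \<open>Sdual A\<close>. The
      first stage must hold on all of \<open>C\<close> to feed the second.\<close>
    have "Sdual ([n] @ B) g = 0" if "g \<in> C" for g
      unfolding Sdual_append[OF v(2,3)]
      using S[OF n(2,3)] that by (intro NSym_mult_annihilates[OF C(1)] Sdual_carrier v) blast+
    then have "Sdual I h = 0"
      unfolding AB Sdual_append[OF v(1,4)]
      using h by (intro NSym_mult_annihilates[OF C(1)] Sdual_carrier v) blast+
    then show False using I(2) h C(2) by (auto simp: Sdual_def)
  qed
  have "(\<Sum>I | I \<in> vcomps \<and> Mcoeff I h \<noteq> 0. scl (Mcoeff I h) (M I)) \<in> fvs.span (M ` even_comps k)"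
    using coeff by (intro fvs.span_sum fvs.span_scale fvs.span_base) blast
  then show "h \<in> fvs.span (M ` even_comps k)" using QSym_expand(2)[of h] h C(2) by auto
qed

theorem theorem5p22:
  fixes k :: "'l::finite \<Rightarrow> enat"
  shows "even_ideal k = genideal NSym {Sdual [n] | n. 0 < n \<and> mdeg_le n k \<and> odd (tdeg n)} \<and>
         even_subalgebra k =
           fvs.span {M I | I. I \<in> vcomps \<and> (\<forall>n\<in>set I. mdeg_le n k \<longrightarrow> even (tdeg n))}"
proof
  have "even_subalgebra k = fvs.span (M ` even_comps k)"
    using even_subcoalgebra_subset_span[OF even_subalgebra_greatest(1)]
      even_subalgebra_greatest(2)[OF even_subcoalgebra_span] by (rule equalityI)
  also have "M ` even_comps k = {M I | I. I \<in> vcomps \<and> (\<forall>n\<in>set I. mdeg_le n k \<longrightarrow> even (tdeg n))}"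
    by (auto simp: even_comps_def)
  finally show "even_subalgebra k =
      fvs.span {M I | I. I \<in> vcomps \<and> (\<forall>n\<in>set I. mdeg_le n k \<longrightarrow> even (tdeg n))}" .
qed (rule even_ideal_eq)

end
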